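(* Let $n\ge1$ and let $(C,D)$ be a disjoint pair of $n$-ary RE relations. If $(C,D)$ is weakly effectively inseparable (WEI), then $(C,D)$ is doubly universal.
   Context: $\langle R^n_i\rangle$ is an acceptable enumeration of all $n$-ary RE relations. An $n$-ary functional on $\mathbb N^m$ is a map $F=(f_1,\dots,f_n):\mathbb N^m\to\mathbb N^n$, recursive if each $f_i$ is. A disjoint pair $(C,D)$ of $n$-ary RE relations is WEI if there is a recursive $n$-ary functional $F$ on $\mathbb N^2$ such that for all $i,j\in\omega$: (i) if $R^n_i=C$ and $R^n_j=D$ then $F(i,j)\notin C\cup D$; (ii) if $R^n_i=C$ and $R^n_j=D\cup\{F(i,j)\}$ then $F(i,j)\in C$; (iii) if $R^n_i=C\cup\{F(i,j)\}$ and $R^n_j=D$ then $F(i,j)\in D$. A recursive $n$-ary functional $G$ on $\mathbb N^n$ is a reduction from a disjoint pair $(A,B)$ of $n$-ary RE relations to $(C,D)$ if for all $\vec a$: $\vec a\in A\Leftrightarrow G(\vec a)\in C$ and $\vec a\in B\Leftrightarrow G(\vec a)\in D$. $(C,D)$ is doubly universal if every disjoint pair of $n$-ary RE relations has a reduction to $(C,D)$. *)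

theory Defs
  imports Main
begin

text \<open>
  A tuple in \<open>\<nat>\<^sup>n\<close> is a list of natural numbers of length \<open>n\<close>.  Functions on \<open>\<nat>\<^sup>n\<close> are
  functions on all lists, of which only the values on lists of length \<open>n\<close> matter; hence the
  closure rule \<open>ext\<close> below.

  The total recursive functions are Kleene's: \<open>mu\<close> applies only if the minimization
  succeeds for all arguments.
\<close>

inductive recursive_fun :: "nat \<Rightarrow> (nat list \<Rightarrow> nat) \<Rightarrow> bool" where
  zero: "recursive_fun n (\<lambda>xs. 0)"
| succ: "recursive_fun 1 (\<lambda>xs. Suc (xs ! 0))"
| proj: "i < n \<Longrightarrow> recursive_fun n (\<lambda>xs. xs ! i)"
| comp: "recursive_fun (length gs) f \<Longrightarrow> \<forall>g\<in>set gs. recursive_fun n g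
    \<Longrightarrow> recursive_fun n (\<lambda>xs. f (map (\<lambda>g. g xs) gs))"
| prim: "recursive_fun n f \<Longrightarrow> recursive_fun (Suc (Suc n)) g
    \<Longrightarrow> recursive_fun (Suc n)
          (\<lambda>xs. rec_nat (f (tl xs)) (\<lambda>y r. g (y # r # tl xs)) (hd xs))"
| mu: "recursive_fun (Suc n) g \<Longrightarrow> \<forall>xs. length xs = n \<longrightarrow> (\<exists>y. g (y # xs) = 0)
    \<Longrightarrow> recursive_fun n (\<lambda>xs. LEAST y. g (y # xs) = 0)"
| ext: "recursive_fun n f \<Longrightarrow> \<forall>xs. length xs = n \<longrightarrow> g xs = f xs \<Longrightarrow> recursive_fun n g"

definition recursive_rel :: "nat \<Rightarrow> nat list set \<Rightarrow> bool" where
  "recursive_rel n Q \<longleftrightarrow>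
     Q \<subseteq> {xs. length xs = n} \<and> recursive_fun n (\<lambda>xs. if xs \<in> Q then 1 else 0)"

definition RE_rel :: "nat \<Rightarrow> nat list set \<Rightarrow> bool" where
  "RE_rel n A \<longleftrightarrow>
     (\<exists>Q. recursive_rel (Suc n) Q \<and> A = {xs. length xs = n \<and> (\<exists>y. y # xs \<in> Q)})"

text \<open>
  Acceptability of an enumeration \<open>R\<close> of the \<open>n\<close>-ary RE relations is given by the enumeration
  theorem (the relation \<open>xs \<in> R i\<close> is RE in \<open>i\<close> and \<open>xs\<close>) and the s-m-n theorem (an index of
  a section of an RE relation is recursive in the parameters).
\<close>

definition acceptable_enumeration :: "nat \<Rightarrow> (nat \<Rightarrow> nat list set) \<Rightarrow> bool" where
  "acceptable_enumeration n R \<longleftrightarrow>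
     range R = {A. RE_rel n A} \<and>
     RE_rel (Suc n) {i # xs | i xs. xs \<in> R i} \<and>
     (\<forall>m S. RE_rel (m + n) S \<longrightarrow>
        (\<exists>s. recursive_fun m s \<and>
          (\<forall>ys. length ys = m \<longrightarrow> R (s ys) = {xs. length xs = n \<and> ys @ xs \<in> S})))"

text \<open>\<open>recursive_functional n m F\<close>: \<open>F\<close> is a recursive \<open>n\<close>-ary functional on \<open>\<nat>\<^sup>m\<close>.\<close>

definition recursive_functional :: "nat \<Rightarrow> nat \<Rightarrow> (nat list \<Rightarrow> nat list) \<Rightarrow> bool" where
  "recursive_functional n m F \<longleftrightarrow>
     (\<forall>xs. length xs = m \<longrightarrow> length (F xs) = n) \<and>
     (\<forall>k<n. recursive_fun m (\<lambda>xs. F xs ! k))"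

definition disjoint_RE_pair :: "nat \<Rightarrow> nat list set \<Rightarrow> nat list set \<Rightarrow> bool" where
  "disjoint_RE_pair n A B \<longleftrightarrow> RE_rel n A \<and> RE_rel n B \<and> A \<inter> B = {}"

definition WEI :: "nat \<Rightarrow> (nat \<Rightarrow> nat list set) \<Rightarrow> nat list set \<Rightarrow> nat list set \<Rightarrow> bool" where
  "WEI n R C D \<longleftrightarrow> disjoint_RE_pair n C D \<and>
     (\<exists>F. recursive_functional n 2 F \<and>
       (\<forall>i j.
         (R i = C \<and> R j = D \<longrightarrow> F [i, j] \<notin> C \<union> D) \<and>
         (R i = C \<and> R j = D \<union> {F [i, j]} \<longrightarrow> F [i, j] \<in> C) \<and>
         (R i = C \<union> {F [i, j]} \<and> R j = D \<longrightarrow> F [i, j] \<in> D)))"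

definition reduction ::
  "nat \<Rightarrow> (nat list \<Rightarrow> nat list) \<Rightarrow> nat list set \<Rightarrow> nat list set \<Rightarrow> nat list set \<Rightarrow> nat list set \<Rightarrow> bool"
  where
  "reduction n G A B C D \<longleftrightarrow> recursive_functional n n G \<and>
     (\<forall>a. length a = n \<longrightarrow> (a \<in> A \<longleftrightarrow> G a \<in> C) \<and> (a \<in> B \<longleftrightarrow> G a \<in> D))"

definition doubly_universal :: "nat \<Rightarrow> nat list set \<Rightarrow> nat list set \<Rightarrow> bool" where
  "doubly_universal n C D \<longleftrightarrow> disjoint_RE_pair n C D \<and>
     (\<forall>A B. disjoint_RE_pair n A B \<longrightarrow> (\<exists>G. reduction n G A B C D))"

end

theory Submission
  imports Defs "HOL-Library.Nat_Bijection"
begin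

text \<open>
  Let \<open>F\<close> witness that \<open>(C, D)\<close> is WEI and let \<open>(A, B)\<close> be a disjoint RE pair.  By the double
  recursion theorem with parameters there are recursive \<open>f\<close>, \<open>g\<close> such that, with
  \<open>G a = F [f a, g a]\<close>, the set \<open>R (f a)\<close> is \<open>C\<close> together with \<open>G a\<close> if \<open>a \<in> B\<close>, and \<open>R (g a)\<close>
  is \<open>D\<close> together with \<open>G a\<close> if \<open>a \<in> A\<close>.  The three clauses of WEI then say that \<open>G a\<close> lies in
  \<open>C\<close> if \<open>a \<in> A\<close>, in \<open>D\<close> if \<open>a \<in> B\<close>, and outside \<open>C \<union> D\<close> otherwise.

  The recursion theorem diagonalizes over relations of an arity larger than \<open>n\<close>, whereas
  \<open>R\<close> only enumerates \<open>n\<close>-ary ones.  As \<open>n \<ge> 1\<close>, a tuple of any length can be coded into the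
  first component of an \<open>n\<close>-tuple, which turns \<open>R\<close> into an enumeration for every arity.
\<close>

section \<open>Recursive functions\<close>

lemma recursive_fun_comp1:
  assumes "recursive_fun 1 h" "recursive_fun n f"
  shows "recursive_fun n (\<lambda>xs. h [f xs])"
  using recursive_fun.comp[of "[f]" h n] assms by simp

lemma recursive_fun_comp2:
  assumes "recursive_fun 2 h" "recursive_fun n f" "recursive_fun n g"
  shows "recursive_fun n (\<lambda>xs. h [f xs, g xs])"
  using recursive_fun.comp[of "[f, g]" h n] assms by (simp add: numeral_2_eq_2)

lemma recursive_fun_Suc:
  assumes "recursive_fun n f"
  shows "recursive_fun n (\<lambda>xs. Suc (f xs))"
  using recursive_fun_comp1[OF recursive_fun.succ assms] by simp

lemma recursive_fun_const: "recursive_fun n (\<lambda>xs. c)"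
  by (induction c) (auto intro: recursive_fun.zero recursive_fun_Suc)

lemma recursive_fun_add:
  assumes "recursive_fun n f" "recursive_fun n g"
  shows "recursive_fun n (\<lambda>xs. f xs + g xs)"
proof -
  have rec: "rec_nat b (\<lambda>y. Suc) a = a + b" for a b
    by (induction a) auto
  have "recursive_fun (Suc 1)
      (\<lambda>xs. rec_nat (tl xs ! 0) (\<lambda>y r. Suc ((y # r # tl xs) ! 1)) (hd xs))"
    by (intro recursive_fun.prim recursive_fun_Suc recursive_fun.proj) auto
  then have "recursive_fun 2 (\<lambda>xs. hd xs + tl xs ! 0)"
    by (simp add: rec numeral_2_eq_2)
  from recursive_fun_comp2[OF this assms] show ?thesis
    by simp
qed

lemma recursive_fun_diff:
  assumes "recursive_fun n f" "recursive_fun n g"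
  shows "recursive_fun n (\<lambda>xs. f xs - g xs)"
proof -
  have rec_pred: "rec_nat 0 (\<lambda>y r. y) a = a - 1" for a :: nat
    by (cases a) auto
  have rec_diff: "rec_nat b (\<lambda>y r. r - Suc 0) a = b - a" for a b
    by (induction a) auto
  have "recursive_fun (Suc 0)
      (\<lambda>xs. rec_nat 0 (\<lambda>y r. (y # r # tl xs) ! 0) (hd xs))"
    by (intro recursive_fun.prim recursive_fun.proj recursive_fun.zero) auto
  then have "recursive_fun 1 (\<lambda>xs. hd xs - 1)"
    by (simp add: rec_pred)
  from recursive_fun_comp1[OF this]
  have pred: "recursive_fun k (\<lambda>xs. h xs - 1)" if "recursive_fun k h" for k h
    using that by simp
  \<comment> \<open>\<open>prim\<close> recurses on the head of the list, so here the subtrahend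
    comes first; the final composition swaps the arguments back.\<close>
  have "recursive_fun (Suc 1)
      (\<lambda>xs. rec_nat (tl xs ! 0) (\<lambda>y r. (y # r # tl xs) ! 1 - 1) (hd xs))"
    by (intro recursive_fun.prim pred recursive_fun.proj) auto
  then have "recursive_fun 2 (\<lambda>xs. tl xs ! 0 - hd xs)"
    by (simp add: rec_diff numeral_2_eq_2)
  from recursive_fun_comp2[OF this assms(2,1)] show ?thesis
    by simp
qed

section \<open>Tuple-valued recursive functions and their composition\<close>

lemma recursive_functional_nth:
  "recursive_functional k m F \<Longrightarrow> i < k \<Longrightarrow> recursive_fun m (\<lambda>xs. F xs ! i)"
  by (simp add: recursive_functional_def)

lemma recursive_functional_length:
  "recursive_functional k m F \<Longrightarrow> length xs = m \<Longrightarrow> length (F xs) = k"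
  by (simp add: recursive_functional_def)

text \<open>\<open>comp\<close> takes a list of functions, so \<open>F\<close> is split into its
  \<open>k\<close> coordinate functions. Reassembling them is known to give \<open>F xs\<close> only
  if \<open>length xs = m\<close>, hence the use of \<open>ext\<close>.\<close>

lemma recursive_fun_comp:
  assumes "recursive_fun k f" "recursive_functional k m F"
  shows "recursive_fun m (\<lambda>xs. f (F xs))"
proof -
  let ?gs = "map (\<lambda>i xs. F xs ! i) [0..<k]"
  have "recursive_fun m (\<lambda>xs. f (map (\<lambda>g. g xs) ?gs))"
    using assms by (intro recursive_fun.comp) (auto intro: recursive_functional_nth)
  moreover have "map (\<lambda>g. g xs) ?gs = F xs" if "length xs = m" for xs
    using recursive_functional_length[OF assms(2) that] by (auto intro: nth_equalityI)
  ultimately show ?thesis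
    by (auto intro: recursive_fun.ext)
qed

lemma recursive_functional_comp:
  assumes "recursive_functional l k G" "recursive_functional k m F"
  shows "recursive_functional l m (\<lambda>xs. G (F xs))"
  using assms(1) recursive_functional_length[OF assms(2)]
  by (auto simp: recursive_functional_def intro: recursive_fun_comp[OF _ assms(2)])

lemma recursive_functional_Nil: "recursive_functional 0 m (\<lambda>xs. [])"
  by (simp add: recursive_functional_def)

lemma recursive_functional_Cons:
  assumes "recursive_fun m f" "recursive_functional k m F"
  shows "recursive_functional (Suc k) m (\<lambda>xs. f xs # F xs)"
  unfolding recursive_functional_def
proof (intro conjI allI impI)
  fix i assume "i < Suc k"
  then show "recursive_fun m (\<lambda>xs. (f xs # F xs) ! i)"
    using assms by (cases i) (auto simp: recursive_functional_def)
qed (use assms in \<open>simp add: recursive_functional_def\<close>)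

lemma recursive_functional_id: "recursive_functional m m (\<lambda>xs. xs)"
  by (simp add: recursive_functional_def recursive_fun.proj)

lemma recursive_functional_take:
  "k \<le> m \<Longrightarrow> recursive_functional k m (\<lambda>xs. take k xs)"
  by (simp add: recursive_functional_def recursive_fun.proj)

lemma recursive_functional_drop:
  "k + l = m \<Longrightarrow> recursive_functional l m (\<lambda>xs. drop k xs)"
  unfolding recursive_functional_def
proof safe
  fix i assume "m = k + l" "i < l"
  then show "recursive_fun (k + l) (\<lambda>xs. drop k xs ! i)"
    by (intro recursive_fun.ext[OF recursive_fun.proj[of "k + i"]]) auto
qed auto

lemma recursive_functional_replicate:
  "recursive_functional k m (\<lambda>xs. replicate k c)"
  by (simp add: recursive_functional_def recursive_fun_const)

lemmas recursive_functional_intros =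
  recursive_functional_Nil recursive_functional_Cons recursive_functional_id
  recursive_functional_take recursive_functional_drop recursive_functional_replicate

section \<open>Recursive and recursively enumerable relations\<close>

lemma recursive_rel_vimage:
  assumes "recursive_rel k Q" "recursive_functional k m F"
  shows "recursive_rel m {xs. length xs = m \<and> F xs \<in> Q}"
  unfolding recursive_rel_def
proof
  have "recursive_fun k (\<lambda>xs. if xs \<in> Q then 1 else 0)"
    using assms(1) by (simp add: recursive_rel_def)
  from recursive_fun_comp[OF this assms(2)]
  show "recursive_fun m (\<lambda>xs. if xs \<in> {xs. length xs = m \<and> F xs \<in> Q} then 1 else 0)"
    by (rule recursive_fun.ext) auto
qed auto

lemma recursive_rel_Un:
  assumes "recursive_rel n P" "recursive_rel n Q"
  shows "recursive_rel n (P \<union> Q)"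
  unfolding recursive_rel_def
proof
  \<comment> \<open>By truncated subtraction, \<open>1 - (1 - k)\<close> is 0 for
    \<open>k = 0\<close> and 1 otherwise.\<close>
  have "recursive_fun n
      (\<lambda>xs. 1 - (1 - ((if xs \<in> P then 1 else 0) + (if xs \<in> Q then 1 else 0))))"
    using assms unfolding recursive_rel_def
    by (intro recursive_fun_diff recursive_fun_add recursive_fun_const) auto
  then show "recursive_fun n (\<lambda>xs. if xs \<in> P \<union> Q then 1 else 0)"
    by (rule recursive_fun.ext) auto
qed (use assms in \<open>auto simp: recursive_rel_def\<close>)

lemma recursive_rel_Int:
  assumes "recursive_rel n P" "recursive_rel n Q"
  shows "recursive_rel n (P \<inter> Q)"
  unfolding recursive_rel_def
proof
  have "recursive_fun n
      (\<lambda>xs. (if xs \<in> P then 1 else 0) + (if xs \<in> Q then 1 else 0) - 1)"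
    using assms unfolding recursive_rel_def
    by (intro recursive_fun_diff recursive_fun_add recursive_fun_const) auto
  then show "recursive_fun n (\<lambda>xs. if xs \<in> P \<inter> Q then 1 else 0)"
    by (rule recursive_fun.ext) auto
qed (use assms in \<open>auto simp: recursive_rel_def\<close>)

lemma recursive_rel_eq_fun:
  assumes "recursive_fun m f" "recursive_fun m g"
  shows "recursive_rel m {xs. length xs = m \<and> f xs = g xs}"
  unfolding recursive_rel_def
proof
  \<comment> \<open>The two truncated differences add up to the distance of the values.\<close>
  have "recursive_fun m (\<lambda>xs. 1 - ((f xs - g xs) + (g xs - f xs)))"
    using assms by (intro recursive_fun_diff recursive_fun_add recursive_fun_const)
  then show "recursive_fun m (\<lambda>xs. if xs \<in> {xs. length xs = m \<and> f xs = g xs} then 1 else 0)"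
    by (rule recursive_fun.ext) auto
qed auto

lemma recursive_rel_eq_functional:
  assumes "recursive_functional k m F" "recursive_functional k m G"
  shows "recursive_rel m {xs. length xs = m \<and> F xs = G xs}"
proof -
  \<comment> \<open>Induction on the number \<open>l\<close> of coordinates compared, intersecting
    with one equation at a time.\<close>
  have rec: "recursive_rel m {xs. length xs = m \<and> (\<forall>i<l. F xs ! i = G xs ! i)}" if "l \<le> k" for l
    using that
  proof (induction l)
    case 0
    show ?case
      using recursive_rel_eq_fun[OF recursive_fun.zero recursive_fun.zero, of m] by simp
  next
    case (Suc l)
    have "{xs. length xs = m \<and> (\<forall>i<Suc l. F xs ! i = G xs ! i)} =
        {xs. length xs = m \<and> (\<forall>i<l. F xs ! i = G xs ! i)} \<inter>
        {xs. length xs = m \<and> F xs ! l = G xs ! l}"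
      by (auto simp: less_Suc_eq)
    moreover have "recursive_rel m {xs. length xs = m \<and> F xs ! l = G xs ! l}"
      using assms Suc.prems
      by (intro recursive_rel_eq_fun recursive_functional_nth[of k]) auto
    ultimately show ?case
      using Suc by (simp only: recursive_rel_Int Suc_leD)
  qed
  have "(\<forall>i<k. F xs ! i = G xs ! i) \<longleftrightarrow> F xs = G xs" if "length xs = m" for xs
    using assms that by (simp add: list_eq_iff_nth_eq recursive_functional_length)
  then have "{xs. length xs = m \<and> (\<forall>i<k. F xs ! i = G xs ! i)} =
      {xs. length xs = m \<and> F xs = G xs}"
    by blast
  with rec[OF order_refl] show ?thesis
    by simp
qed

lemma RE_rel_length: "RE_rel n A \<Longrightarrow> xs \<in> A \<Longrightarrow> length xs = n"
  by (auto simp: RE_rel_def)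

lemma RE_rel_vimage:
  assumes "RE_rel k A" "recursive_functional k m F"
  shows "RE_rel m {xs. length xs = m \<and> F xs \<in> A}"
proof -
  obtain Q where Q: "recursive_rel (Suc k) Q" "A = {xs. length xs = k \<and> (\<exists>y. y # xs \<in> Q)}"
    using assms(1) by (auto simp: RE_rel_def)
  \<comment> \<open>The witness at the head is kept; \<open>F\<close> acts on the rest only.\<close>
  have "recursive_functional (Suc k) (Suc m) (\<lambda>xs. xs ! 0 # F (drop 1 xs))"
    by (intro recursive_functional_Cons recursive_fun.proj
        recursive_functional_comp[OF assms(2)] recursive_functional_drop) auto
  note recursive_rel_vimage[OF Q(1) this]
  moreover have "{xs. length xs = m \<and> F xs \<in> A} = {xs. length xs = m \<and>
      (\<exists>y. y # xs \<in> {xs. length xs = Suc m \<and> xs ! 0 # F (drop 1 xs) \<in> Q})}"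
    using recursive_functional_length[OF assms(2)] by (auto simp: Q(2))
  ultimately show ?thesis
    unfolding RE_rel_def by blast
qed

lemma RE_rel_Un:
  assumes "RE_rel n A" "RE_rel n B"
  shows "RE_rel n (A \<union> B)"
proof -
  obtain P Q where "recursive_rel (Suc n) P" "A = {xs. length xs = n \<and> (\<exists>y. y # xs \<in> P)}"
    and "recursive_rel (Suc n) Q" "B = {xs. length xs = n \<and> (\<exists>y. y # xs \<in> Q)}"
    using assms by (auto simp: RE_rel_def)
  then show ?thesis
    unfolding RE_rel_def by (intro exI[of _ "P \<union> Q"]) (auto intro: recursive_rel_Un)
qed

text \<open>Membership in \<open>P\<close> is decidable and can be tested inside the matrix of
  \<open>A\<close>, so no two witnesses have to be merged into one.\<close>

lemma RE_rel_Int_recursive: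
  assumes "RE_rel n A" "recursive_rel n P"
  shows "RE_rel n (A \<inter> P)"
proof -
  obtain Q where Q: "recursive_rel (Suc n) Q" "A = {xs. length xs = n \<and> (\<exists>y. y # xs \<in> Q)}"
    using assms(1) by (auto simp: RE_rel_def)
  have "recursive_rel (Suc n) (Q \<inter> {xs. length xs = Suc n \<and> drop 1 xs \<in> P})"
    by (intro recursive_rel_Int Q(1) recursive_rel_vimage[OF assms(2)] recursive_functional_drop) auto
  moreover have "A \<inter> P = {xs. length xs = n \<and>
      (\<exists>y. y # xs \<in> Q \<inter> {xs. length xs = Suc n \<and> drop 1 xs \<in> P})}"
    by (auto simp: Q(2))
  ultimately show ?thesis
    unfolding RE_rel_def by blast
qed

section \<open>Coding of tuples\<close>

lemma recursive_fun_triangle: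
  assumes "recursive_fun n f"
  shows "recursive_fun n (\<lambda>xs. triangle (f xs))"
proof -
  have rec: "rec_nat 0 (\<lambda>y r. Suc (r + y)) a = triangle a" for a
    by (induction a) auto
  have "recursive_fun (Suc 0)
      (\<lambda>xs. rec_nat 0 (\<lambda>y r. (y # r # tl xs) ! 1 + Suc ((y # r # tl xs) ! 0)) (hd xs))"
    by (intro recursive_fun.prim recursive_fun.proj recursive_fun.zero
        recursive_fun_add recursive_fun_Suc) auto
  then have "recursive_fun 1 (\<lambda>xs. triangle (hd xs))"
    by (simp add: rec)
  from recursive_fun_comp1[OF this assms] show ?thesis
    by simp
qed

lemma recursive_fun_prod_encode:
  assumes "recursive_fun n f" "recursive_fun n g"
  shows "recursive_fun n (\<lambda>xs. prod_encode (f xs, g xs))"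
  unfolding prod_encode_def prod.case
  by (intro recursive_fun_add recursive_fun_triangle assms)

lemma triangle_mono: "m \<le> n \<Longrightarrow> triangle m \<le> triangle n"
  by (induction rule: dec_induct) auto

text \<open>The code of \<open>(a, b)\<close> is \<open>triangle (a + b) + a\<close>, which is at
  least \<open>triangle (a + b)\<close> and below \<open>triangle (Suc (a + b))\<close>. Searching
  for this interval recovers the sum, and with it both components.\<close>

lemma Least_triangle_prod_encode:
  "(LEAST s. prod_encode (a, b) < triangle (Suc s)) = a + b"
proof (rule Least_equality)
  fix s assume "prod_encode (a, b) < triangle (Suc s)"
  then have "triangle (a + b) < triangle (Suc s)"
    by (simp add: prod_encode_def)
  then show "a + b \<le> s"
    by (meson not_less_eq_eq triangle_mono linorder_not_less)
qed (simp add: prod_encode_def)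

lemma recursive_fun_prod_decode:
  assumes "recursive_fun n f"
  shows "recursive_fun n (\<lambda>xs. fst (prod_decode (f xs)))"
    and "recursive_fun n (\<lambda>xs. snd (prod_decode (f xs)))"
proof -
  define s where "s c = (LEAST s. c < triangle (Suc s))" for c
  \<comment> \<open>The difference vanishes exactly if \<open>c < triangle (Suc y)\<close>. The
    value \<open>y = c\<close> guarantees the successful search that \<open>mu\<close>
    demands.\<close>
  have "\<exists>y. Suc c - triangle (Suc y) = 0" for c
    by (intro exI[of _ c]) simp
  then have "recursive_fun 1
      (\<lambda>xs. LEAST y. Suc ((y # xs) ! 1) - triangle (Suc ((y # xs) ! 0)) = 0)"
    by (intro recursive_fun.mu recursive_fun_diff recursive_fun_Suc recursive_fun_triangle
        recursive_fun.proj) auto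
  from recursive_fun_comp1[OF this assms] have s: "recursive_fun n (\<lambda>xs. s (f xs))"
    by (simp add: s_def less_Suc_eq_le)
  have fst: "fst (prod_decode c) = c - triangle (s c)"
    and snd: "snd (prod_decode c) = s c - (c - triangle (s c))" for c
  proof -
    obtain a b where c: "c = prod_encode (a, b)"
      by (metis prod_decode_inverse surj_pair)
    have "s c = a + b"
      by (simp only: s_def c Least_triangle_prod_encode)
    then show "fst (prod_decode c) = c - triangle (s c)"
      "snd (prod_decode c) = s c - (c - triangle (s c))"
      by (simp_all add: c) (simp_all add: prod_encode_def)
  qed
  show "recursive_fun n (\<lambda>xs. fst (prod_decode (f xs)))"
    "recursive_fun n (\<lambda>xs. snd (prod_decode (f xs)))"
    unfolding fst snd
    by (intro recursive_fun_diff recursive_fun_triangle s assms)+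
qed

text \<open>The length is not part of the code but is passed to the decoder; tuples of different
  lengths may share a code.\<close>

fun tuple_encode :: "nat list \<Rightarrow> nat" where
  "tuple_encode [] = 0"
| "tuple_encode (x # xs) = prod_encode (x, tuple_encode xs)"

fun tuple_decode :: "nat \<Rightarrow> nat \<Rightarrow> nat list" where
  "tuple_decode 0 c = []"
| "tuple_decode (Suc k) c = fst (prod_decode c) # tuple_decode k (snd (prod_decode c))"

lemma tuple_decode_encode: "tuple_decode (length xs) (tuple_encode xs) = xs"
  by (induction xs) auto

lemma recursive_fun_tuple_encode: "recursive_fun k tuple_encode"
proof (induction k)
  case 0
  show ?case
    by (rule recursive_fun.ext[OF recursive_fun.zero]) auto
next
  case (Suc k)
  have "recursive_fun (Suc k) (\<lambda>xs. prod_encode (xs ! 0, tuple_encode (drop 1 xs)))"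
    by (intro recursive_fun_prod_encode recursive_fun.proj recursive_fun_comp[OF Suc]
        recursive_functional_drop) auto
  then show ?case
    by (rule recursive_fun.ext) (auto simp: length_Suc_conv)
qed

lemma recursive_functional_tuple_decode:
  "recursive_fun m f \<Longrightarrow> recursive_functional k m (\<lambda>xs. tuple_decode k (f xs))"
proof (induction k arbitrary: f)
  case 0
  show ?case
    by (simp add: recursive_functional_Nil)
next
  case (Suc k)
  show ?case
    unfolding tuple_decode.simps
    by (intro recursive_functional_Cons recursive_fun_prod_decode Suc)
qed

section \<open>The double recursion theorem\<close>

lemma acceptable_enumeration_smn:
  assumes "acceptable_enumeration n R" "RE_rel (m + n) S"
  obtains s where "recursive_fun m s"
    and "\<And>ys. length ys = m \<Longrightarrow> R (s ys) = {xs. length xs = n \<and> ys @ xs \<in> S}"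
proof -
  have "\<forall>m S. RE_rel (m + n) S \<longrightarrow> (\<exists>s. recursive_fun m s \<and>
      (\<forall>ys. length ys = m \<longrightarrow> R (s ys) = {xs. length xs = n \<and> ys @ xs \<in> S}))"
    using assms(1) unfolding acceptable_enumeration_def by (elim conjE)
  from this[rule_format, OF assms(2)] show thesis
    using that by blast
qed

text \<open>\<open>W\<close> accepts \<open>e # zs\<close> if \<open>R e\<close> contains the code
  of \<open>zs\<close>, padded with zeros to length \<open>n\<close>. The hypothesis
  \<open>n \<ge> 1\<close> provides the component that holds the code.\<close>

lemma universal_RE_rel:
  assumes "n \<ge> 1" "acceptable_enumeration n R"
  obtains W where "RE_rel (Suc l) W"
    and "\<forall>S. RE_rel l S \<longrightarrow> (\<exists>e. \<forall>zs. length zs = l \<longrightarrow> (e # zs \<in> W \<longleftrightarrow> zs \<in> S))"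
proof
  let ?code = "\<lambda>zs. tuple_encode zs # replicate (n - 1) 0"
  let ?E = "{i # xs | i xs. xs \<in> R i}"
  let ?W = "{ezs. length ezs = Suc l \<and> ezs ! 0 # ?code (drop 1 ezs) \<in> ?E}"
  have "recursive_functional (Suc (Suc (n - 1))) (Suc l) (\<lambda>ezs. ezs ! 0 # ?code (drop 1 ezs))"
    by (intro recursive_functional_intros recursive_fun.proj
        recursive_fun_comp[OF recursive_fun_tuple_encode]) auto
  then have "recursive_functional (Suc n) (Suc l) (\<lambda>ezs. ezs ! 0 # ?code (drop 1 ezs))"
    using assms(1) by simp
  moreover have "RE_rel (Suc n) ?E"
    using assms(2) by (simp add: acceptable_enumeration_def)
  ultimately show "RE_rel (Suc l) ?W"
    by (rule RE_rel_vimage[rotated])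
  show "\<forall>S. RE_rel l S \<longrightarrow> (\<exists>e. \<forall>zs. length zs = l \<longrightarrow> (e # zs \<in> ?W \<longleftrightarrow> zs \<in> S))"
  proof (intro allI impI)
    fix S assume S: "RE_rel l S"
    \<comment> \<open>Pulling \<open>S\<close> back along decoding gives an \<open>n\<close>-ary RE
      relation, which has an index because \<open>R\<close> is onto these relations.\<close>
    have "RE_rel n {xs. length xs = n \<and> tuple_decode l (xs ! 0) \<in> S}"
      using assms(1)
      by (intro RE_rel_vimage[OF S] recursive_functional_tuple_decode recursive_fun.proj) auto
    then obtain e where "R e = {xs. length xs = n \<and> tuple_decode l (xs ! 0) \<in> S}"
      using assms(2) unfolding acceptable_enumeration_def by (metis (lifting) imageE mem_Collect_eq)
    then show "\<exists>e. \<forall>zs. length zs = l \<longrightarrow> (e # zs \<in> ?W \<longleftrightarrow> zs \<in> S)"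
      using assms(1) by (intro exI[of _ e]) (auto simp: tuple_decode_encode)
  qed
qed

text \<open>Kleene's diagonal argument with two indices at once and parameters \<open>ys\<close>:
  the solutions are \<open>s\<close> and \<open>t\<close> evaluated at suitable
  \<open>W\<close>-indices \<open>p\<close>, \<open>q\<close> followed by \<open>ys\<close>.\<close>

lemma double_recursion:
  assumes "n \<ge> 1" "acceptable_enumeration n R"
    and S: "RE_rel (2 + m + n) S" and T: "RE_rel (2 + m + n) T"
  obtains f g where "recursive_fun m f" "recursive_fun m g"
    and "\<And>ys. length ys = m \<Longrightarrow> R (f ys) = {xs. length xs = n \<and> f ys # g ys # ys @ xs \<in> S}"
    and "\<And>ys. length ys = m \<Longrightarrow> R (g ys) = {xs. length xs = n \<and> f ys # g ys # ys @ xs \<in> T}"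
proof -
  let ?l = "2 + m + n"
  obtain W where W: "RE_rel (Suc ?l) W"
    and univ: "\<forall>S. RE_rel ?l S \<longrightarrow>
      (\<exists>e. \<forall>zs. length zs = ?l \<longrightarrow> (e # zs \<in> W \<longleftrightarrow> zs \<in> S))"
    using universal_RE_rel[OF assms(1,2), of ?l] by blast
  \<comment> \<open>The index \<open>ys ! i\<close> is applied to a tuple that begins with both
    indices: this is the self-application. The cases \<open>i = 0\<close> and \<open>i = 1\<close>
    yield \<open>s\<close> and \<open>t\<close>.\<close>
  have smn: "\<exists>s. recursive_fun (2 + m) s \<and>
      (\<forall>ys. length ys = 2 + m \<longrightarrow> R (s ys) = {xs. length xs = n \<and> ys ! i # ys @ xs \<in> W})"
    if "i \<le> 1" for i
  proof -
    have "RE_rel ?l {zs. length zs = ?l \<and> zs ! i # zs \<in> W}"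
      using that
      by (intro RE_rel_vimage[OF W] recursive_functional_intros recursive_fun.proj) auto
    from acceptable_enumeration_smn[OF assms(2) this] obtain s
      where "recursive_fun (2 + m) s" and Rs: "\<And>ys. length ys = 2 + m \<Longrightarrow>
        R (s ys) = {xs. length xs = n \<and> ys @ xs \<in> {zs. length zs = ?l \<and> zs ! i # zs \<in> W}}"
      by blast
    moreover have "R (s ys) = {xs. length xs = n \<and> ys ! i # ys @ xs \<in> W}"
      if "length ys = 2 + m" for ys
      using \<open>i \<le> 1\<close> that by (auto simp: Rs nth_append)
    ultimately show ?thesis
      by blast
  qed
  \<comment> \<open>For indices \<open>p\<close>, \<open>q\<close> in \<open>W\<close>, the indices in \<open>R\<close> of the sections of \<open>W\<^sub>p\<close> and \<open>W\<^sub>q\<close> at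
    \<open>p # q # ys\<close> are \<open>s (p # q # ys)\<close> and \<open>t (p # q # ys)\<close>; so \<open>W\<^sub>p\<close> and \<open>W\<^sub>q\<close> may mention them.\<close>
  obtain s where s: "recursive_fun (2 + m) s"
    and Rs: "\<And>ys. length ys = 2 + m \<Longrightarrow> R (s ys) = {xs. length xs = n \<and> ys ! 0 # ys @ xs \<in> W}"
    using smn[OF le0] by blast
  obtain t where t: "recursive_fun (2 + m) t"
    and Rt: "\<And>ys. length ys = 2 + m \<Longrightarrow> R (t ys) = {xs. length xs = n \<and> ys ! 1 # ys @ xs \<in> W}"
    using smn[OF order_refl] by blast
  \<comment> \<open>\<open>?H\<close> replaces the two leading \<open>W\<close>-indices by the
    \<open>R\<close>-indices computed from them, so that \<open>S\<close> and \<open>T\<close> see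
    the latter.\<close>
  let ?H = "\<lambda>zs. s (take (2 + m) zs) # t (take (2 + m) zs) # drop 2 zs"
  have "recursive_functional (Suc (Suc (m + n))) ?l ?H"
    by (intro recursive_functional_intros recursive_fun_comp[OF s] recursive_fun_comp[OF t]) auto
  then have H: "recursive_functional ?l ?l ?H"
    by simp
  obtain p where p: "\<forall>zs. length zs = ?l \<longrightarrow> (p # zs \<in> W \<longleftrightarrow> ?H zs \<in> S)"
    using univ[rule_format, OF RE_rel_vimage[OF S H]] by auto
  obtain q where q: "\<forall>zs. length zs = ?l \<longrightarrow> (q # zs \<in> W \<longleftrightarrow> ?H zs \<in> T)"
    using univ[rule_format, OF RE_rel_vimage[OF T H]] by auto
  have "recursive_functional (Suc (Suc m)) m (\<lambda>ys. p # q # ys)"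
    by (intro recursive_functional_Cons recursive_functional_id recursive_fun_const)
  then have pq: "recursive_functional (2 + m) m (\<lambda>ys. p # q # ys)"
    by simp
  show thesis
  proof
    show "recursive_fun m (\<lambda>ys. s (p # q # ys))" "recursive_fun m (\<lambda>ys. t (p # q # ys))"
      using recursive_fun_comp[OF s pq] recursive_fun_comp[OF t pq] .
  next
    fix ys :: "nat list" assume "length ys = m"
    then show
      "R (s (p # q # ys)) = {xs. length xs = n \<and> s (p # q # ys) # t (p # q # ys) # ys @ xs \<in> S}"
      "R (t (p # q # ys)) = {xs. length xs = n \<and> s (p # q # ys) # t (p # q # ys) # ys @ xs \<in> T}"
      using p q by (auto simp: Rs Rt)
  qed
qed

section \<open>The reduction obtained from the recursion theorem\<close>

text \<open>Read \<open>zs\<close> as \<open>i # j # a @ x\<close>. For fixed \<open>i\<close>,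
  \<open>j\<close>, \<open>a\<close> the section is \<open>C\<close>, enlarged by
  \<open>F [i, j]\<close> if \<open>a\<close> is in \<open>B\<close>. It is used for
  \<open>C\<close> with \<open>B\<close> and for \<open>D\<close> with \<open>A\<close>.\<close>

lemma RE_rel_add_point:
  assumes C: "RE_rel n C" and B: "RE_rel m B" and F: "recursive_functional n 2 F"
  shows "RE_rel (2 + m + n) {zs. length zs = 2 + m + n \<and>
    (drop (2 + m) zs \<in> C \<or> take m (drop 2 zs) \<in> B \<and> drop (2 + m) zs = F (take 2 zs))}"
proof -
  let ?l = "2 + m + n"
  have "RE_rel ?l ({zs. length zs = ?l \<and> drop (2 + m) zs \<in> C} \<union>
      {zs. length zs = ?l \<and> take m (drop 2 zs) \<in> B} \<inter>
      {zs. length zs = ?l \<and> drop (2 + m) zs = F (take 2 zs)})"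
    by (intro RE_rel_Un RE_rel_Int_recursive RE_rel_vimage[OF C] RE_rel_vimage[OF B]
        recursive_rel_eq_functional[of n] recursive_functional_comp[OF F]
        recursive_functional_comp[OF recursive_functional_take[of m "m + n"]]
        recursive_functional_intros) auto
  then show ?thesis
    by (rule back_subst) auto
qed

theorem theorem6p5:
  fixes n :: nat and R :: "nat \<Rightarrow> nat list set" and C D :: "nat list set"
  assumes "n \<ge> 1"
    and "acceptable_enumeration n R"
    and "disjoint_RE_pair n C D"
    and "WEI n R C D"
  shows "doubly_universal n C D"
  unfolding doubly_universal_def
proof (intro conjI allI impI assms(3))
  fix A B assume AB: "disjoint_RE_pair n A B"
  have CD: "RE_rel n C" "RE_rel n D" "C \<inter> D = {}"
    using assms(3) by (auto simp: disjoint_RE_pair_def)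
  obtain F where F: "recursive_functional n 2 F"
    and wei: "\<And>i j. R i = C \<Longrightarrow> R j = D \<Longrightarrow> F [i, j] \<notin> C \<union> D"
      "\<And>i j. R i = C \<Longrightarrow> R j = D \<union> {F [i, j]} \<Longrightarrow> F [i, j] \<in> C"
      "\<And>i j. R i = C \<union> {F [i, j]} \<Longrightarrow> R j = D \<Longrightarrow> F [i, j] \<in> D"
    using assms(4) by (auto simp: WEI_def)
  have AB': "RE_rel n A" "RE_rel n B" "A \<inter> B = {}"
    using AB by (auto simp: disjoint_RE_pair_def)
  let ?S = "\<lambda>C B. {zs. length zs = 2 + n + n \<and>
    (drop (2 + n) zs \<in> C \<or> take n (drop 2 zs) \<in> B \<and> drop (2 + n) zs = F (take 2 zs))}"
  obtain f g where fg: "recursive_fun n f" "recursive_fun n g"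
    and Rf: "\<And>a. length a = n \<Longrightarrow> R (f a) = {xs. length xs = n \<and> f a # g a # a @ xs \<in> ?S C B}"
    and Rg: "\<And>a. length a = n \<Longrightarrow> R (g a) = {xs. length xs = n \<and> f a # g a # a @ xs \<in> ?S D A}"
    using double_recursion[OF assms(1,2) RE_rel_add_point[OF CD(1) AB'(2) F]
        RE_rel_add_point[OF CD(2) AB'(1) F]] by blast
  let ?G = "\<lambda>a. F [f a, g a]"
  have "recursive_functional (Suc (Suc 0)) n (\<lambda>a. [f a, g a])"
    by (intro recursive_functional_intros fg)
  then have G: "recursive_functional n n ?G"
    using recursive_functional_comp[OF F] by (simp add: numeral_2_eq_2)
  have "(a \<in> A \<longleftrightarrow> ?G a \<in> C) \<and> (a \<in> B \<longleftrightarrow> ?G a \<in> D)" if a: "length a = n" for a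
  proof -
    have Ga: "length (?G a) = n"
      using G a by (rule recursive_functional_length)
    \<comment> \<open>The restriction to lists of length \<open>n\<close> removes nothing, as
      \<open>?G a\<close> and all members of \<open>C\<close> have that length.\<close>
    have f: "R (f a) = (if a \<in> B then C \<union> {?G a} else C)"
      using a Ga RE_rel_length[OF CD(1)] by (auto simp: Rf numeral_2_eq_2)
    have g: "R (g a) = (if a \<in> A then D \<union> {?G a} else D)"
      using a Ga RE_rel_length[OF CD(2)] by (auto simp: Rg numeral_2_eq_2)
    consider "a \<in> A" "a \<notin> B" | "a \<in> B" "a \<notin> A" | "a \<notin> A" "a \<notin> B"
      using AB'(3) by blast
    \<comment> \<open>Each case meets the premises of one clause of \<open>wei\<close>; if it puts
      \<open>?G a\<close> into one of \<open>C\<close> and \<open>D\<close>, disjointness keeps it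
      out of the other.\<close>
    then show ?thesis
      using wei[of "f a" "g a"] f g CD(3) by cases auto
  qed
  with G show "\<exists>G. reduction n G A B C D"
    unfolding reduction_def by blast
qed

end
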